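(* Let $n\ge2$ and let $C$ be a constant. Then there exists $\varepsilon_0>0$, depending on $C$ (for the given $n$), such that the following holds. Suppose that $E\subset\mathbb R^n$ has Lebesgue measure $|E|=0$ and supports a positive, finite, Radon measure $\mu$ such that, for some $\alpha$ with $n-\varepsilon_0<\alpha<n$ and some $\beta$ with $n/2<\beta<n$, $$\sup_{x\in E,\ 0<\rho<1}\frac{\mu(B(x;\rho))}{\rho^\alpha}\le C\qquad\text{and}\qquad \sup_{\xi\in\mathbb R^n}|\widehat\mu(\xi)|(1+|\xi|)^{\beta/2}\le C .$$ Then $E$ contains a parallelogram $\{x,x+y,x+z,x+y+z\}$, where the four points are all distinct.
   Context: $\widehat\mu(\xi)=\int e^{-2\pi i x\cdot\xi}\,d\mu(x)$; $B(x;\rho)$ is the Euclidean ball of center $x$ and radius $\rho$; "$E$ supports $\mu$" means $\operatorname{supp}\mu\subseteq E$. Here $x,y,z\in\mathbb R^n$. *)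

theory Defs
  imports "HOL-Analysis.Analysis"
begin

text \<open>
  On a Euclidean space, inner regularity and outer regularity hold automatically for
  finite Borel measures; they are spelled out because the library has no notion of a
  Radon measure.
\<close>

definition radon_measure :: "'a::euclidean_space measure \<Rightarrow> bool" where
  "radon_measure \<mu> \<longleftrightarrow>
     sets \<mu> = sets borel \<and>
     (\<forall>K. compact K \<longrightarrow> emeasure \<mu> K < \<infinity>) \<and>
     (\<forall>B\<in>sets borel. emeasure \<mu> B = (INF U\<in>{U. open U \<and> B \<subseteq> U}. emeasure \<mu> U)) \<and>
     (\<forall>U. open U \<longrightarrow> emeasure \<mu> U = (SUP K\<in>{K. compact K \<and> K \<subseteq> U}. emeasure \<mu> K))"

text \<open>The topological (closed) support of a measure.\<close>

definition measure_support :: "'a::euclidean_space measure \<Rightarrow> 'a set" where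
  "measure_support \<mu> = {x. \<forall>U. open U \<longrightarrow> x \<in> U \<longrightarrow> emeasure \<mu> U > 0}"

definition fourier_measure :: "'a::euclidean_space measure \<Rightarrow> 'a \<Rightarrow> complex" where
  "fourier_measure \<mu> \<xi> =
     (LINT x|\<mu>. exp (- 2 * complex_of_real pi * \<i> * complex_of_real (x \<bullet> \<xi>)))"

end

theory Submission
  imports Defs "HOL-Probability.Characteristic_Functions"
begin

text \<open>
  Test \<open>\<mu>\<^sup>4\<close> on quadruples
  \<open>(a, b, c, d)\<close> with the Gaussian \<open>t\<^sup>n exp (-\<pi> t\<^sup>2 |a - b - c + d|\<^sup>2)\<close>, whose integral is a weighted
  integral of \<open>|\<mu>^|\<^sup>4\<close>. Restricted to \<open>a, b \<in> K\<^sub>1\<close> and \<open>c, d \<in> K\<^sub>2\<close>, with \<open>K\<^sub>1\<close>, \<open>K\<^sub>2\<close> disjoint compact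
  pieces of the support, this energy increases with \<open>t\<close>, hence stays away from 0. The part near the
  diagonal \<open>a = b\<close> is small uniformly in \<open>t\<close>: an extra Gaussian factor in \<open>a - b\<close> at scale \<open>1/r\<close>
  turns it into an average over \<open>\<eta>\<close> at scale \<open>r\<close> of the correlation
  \<open>\<integral> |\<mu>^(\<xi> + \<eta>)|\<^sup>2 |\<mu>^(\<xi>)|\<^sup>2 d\<xi>\<close>, which tends to 0 as \<open>\<eta>\<close> grows. Away from the diagonal,
  the absence of parallelograms keeps \<open>a - b - c + d\<close> away from 0 by compactness, and the energy
  there vanishes as \<open>t\<close> tends to infinity.
\<close>

section \<open>Characters, Gaussians and their Fourier transforms\<close>

definition unit_character :: "'a::euclidean_space \<Rightarrow> 'a \<Rightarrow> complex" where
  "unit_character x \<xi> = exp (- 2 * complex_of_real pi * \<i> * complex_of_real (x \<bullet> \<xi>))"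

text \<open>The parameter is an inverse width: \<open>gauss t\<close> lives on \<open>|x|\<close> of
  size about \<open>1 / t\<close>. The factor \<open>pi\<close> matches the \<open>2 * pi\<close> in
  the character, so that the transform of \<open>gauss (1 / t)\<close> is
  \<open>t ^ n * gauss t\<close>.\<close>

definition gauss :: "real \<Rightarrow> 'a::euclidean_space \<Rightarrow> real" where
  "gauss t x = exp (- pi * t\<^sup>2 * (norm x)\<^sup>2)"

lemma unit_character_cis: "unit_character x \<xi> = cis (- 2 * pi * (x \<bullet> \<xi>))"
  by (simp add: unit_character_def cis_conv_exp mult_ac)

lemma norm_unit_character [simp]: "norm (unit_character x \<xi>) = 1"
  by (simp add: unit_character_cis)

lemma unit_character_add_left: "unit_character (x + y) \<xi> = unit_character x \<xi> * unit_character y \<xi>"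
  by (simp add: unit_character_cis cis_mult inner_add_left algebra_simps)

lemma unit_character_add_right: "unit_character x (\<xi> + \<eta>) = unit_character x \<xi> * unit_character x \<eta>"
  by (simp add: unit_character_cis cis_mult inner_add_right algebra_simps)

lemma unit_character_minus_left: "unit_character (- x) \<xi> = cnj (unit_character x \<xi>)"
  by (simp add: unit_character_cis cis_cnj)

lemma unit_character_diff_left:
  "unit_character (x - y) \<xi> = unit_character x \<xi> * cnj (unit_character y \<xi>)"
  using unit_character_add_left[of x "- y" \<xi>] by (simp add: unit_character_minus_left)

lemma measurable_unit_character [measurable (raw)]:
  assumes "f \<in> borel_measurable M" "g \<in> borel_measurable M"
  shows "(\<lambda>x. unit_character (f x) (g x)) \<in> borel_measurable M"
  unfolding unit_character_cis cis_conv_exp using assms by measurable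

lemma measurable_gauss [measurable (raw)]:
  assumes "f \<in> borel_measurable M"
  shows "(\<lambda>x. gauss t (f x)) \<in> borel_measurable M"
  unfolding gauss_def using assms by measurable

lemma gauss_pos: "0 < gauss t x"
  by (simp add: gauss_def)

lemma gauss_le_1: "gauss t x \<le> 1"
  by (simp add: gauss_def)

lemma gauss_mono: "\<lbrakk>0 \<le> t; t \<le> s\<rbrakk> \<Longrightarrow> gauss s x \<le> gauss t x"
  by (simp add: gauss_def mult_right_mono power_mono)

text \<open>A linear substitution turns the integral into the characteristic function of the
  standard normal distribution.\<close>

lemma gauss_fourier_real:
  fixes x t :: real
  assumes t: "0 < t"
  shows "has_bochner_integral lborel (\<lambda>\<xi>. complex_of_real (gauss (1 / t) \<xi>) * unit_character x \<xi>)
           (complex_of_real (t * gauss t x))"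
proof -
  \<comment> \<open>With \<open>u = c * \<xi>\<close>, this \<open>c\<close> makes
    \<open>u\<^sup>2 / 2\<close> equal to \<open>pi * \<xi>\<^sup>2 / t\<^sup>2\<close>, and the
    \<open>\<tau>\<close> below makes \<open>\<tau> * u\<close> equal to
    \<open>- 2 * pi * x * \<xi>\<close>.\<close>
  define c where "c = sqrt (2 * pi) / t"
  have c: "0 < c" "c\<^sup>2 = 2 * pi / t\<^sup>2" using t by (simp_all add: c_def power_divide)
  define \<tau> where "\<tau> = - 2 * pi * x / c"
  let ?f = "\<lambda>u. complex_of_real (std_normal_density u) * iexp (\<tau> * u)"
  have int: "integrable lborel ?f"
  proof (rule Bochner_Integration.integrable_bound)
    show "integrable lborel std_normal_density"
      using integrable_normal_moment[of 1 0 0] by simp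
  qed (auto simp: norm_mult)
  have "integral\<^sup>L lborel ?f = char std_normal_distribution \<tau>"
    unfolding char_def by (subst integral_density) (auto simp: scaleR_conv_of_real)
  also have "\<dots> = complex_of_real (exp (- (\<tau>\<^sup>2) / 2))"
    by (simp add: char_std_normal_distribution)
  finally have val: "integral\<^sup>L lborel ?f = complex_of_real (exp (- (\<tau>\<^sup>2) / 2))" .
  have eq: "complex_of_real (gauss (1 / t) \<xi>) * unit_character x \<xi>
              = complex_of_real (sqrt (2 * pi)) * ?f (0 + c * \<xi>)" for \<xi>
  proof -
    have "c\<^sup>2 * \<xi>\<^sup>2 / 2 = pi * (1 / t)\<^sup>2 * \<xi>\<^sup>2"
      unfolding c(2) by (simp add: power_divide)
    moreover have "\<tau> * (c * \<xi>) = - 2 * pi * (x * \<xi>)"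
      using c by (simp add: \<tau>_def)
    ultimately show ?thesis
      by (simp add: unit_character_cis gauss_def std_normal_density_def cis_conv_exp power_mult_distrib
        del: of_real_mult) (auto simp: mult_ac)
  qed
  have "integral\<^sup>L lborel ?f = \<bar>c\<bar> *\<^sub>R (\<integral>\<xi>. ?f (0 + c * \<xi>) \<partial>lborel)"
    using c by (intro lborel_integral_real_affine) simp
  hence "(\<integral>\<xi>. ?f (0 + c * \<xi>) \<partial>lborel) = complex_of_real (exp (- (\<tau>\<^sup>2) / 2)) / c"
    using c val by (simp add: scaleR_conv_of_real field_simps)
  moreover have "integrable lborel (\<lambda>\<xi>. ?f (0 + c * \<xi>))"
    using c int by (intro lborel_integrable_real_affine) simp_all
  ultimately have "has_bochner_integral lborel (\<lambda>\<xi>. ?f (0 + c * \<xi>)) (complex_of_real (exp (- (\<tau>\<^sup>2) / 2)) / c)"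
    by (simp add: has_bochner_integral_iff)
  hence "has_bochner_integral lborel (\<lambda>\<xi>. complex_of_real (gauss (1 / t) \<xi>) * unit_character x \<xi>)
     (complex_of_real (sqrt (2 * pi)) * (complex_of_real (exp (- (\<tau>\<^sup>2) / 2)) / c))"
    unfolding eq by (intro has_bochner_integral_mult_right) simp_all
  moreover have "\<tau>\<^sup>2 / 2 = pi * t\<^sup>2 * x\<^sup>2"
    unfolding \<tau>_def power_divide power_mult_distrib c(2) using t by (simp add: power2_eq_square field_simps)
  moreover have "complex_of_real (sqrt (2 * pi)) * (complex_of_real z / c) = complex_of_real (t * z)" for z
  proof -
    have "sqrt (2 * pi) * (z / c) = t * z" using t by (simp add: c_def)
    thus ?thesis by (metis of_real_mult of_real_divide)
  qed
  ultimately show ?thesis by (simp add: gauss_def)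
qed

lemma gauss_prod: "gauss t x = (\<Prod>b\<in>Basis. gauss t (x \<bullet> b))"
proof -
  have "(norm x)\<^sup>2 = (\<Sum>b\<in>Basis. (x \<bullet> b)\<^sup>2)"
    by (simp add: norm_eq_sqrt_inner euclidean_inner[of x x] power2_eq_square sum_nonneg)
  thus ?thesis
    by (simp add: gauss_def sum_distrib_left exp_sum sum_negf[symmetric])
qed

lemma unit_character_prod: "unit_character x \<xi> = (\<Prod>b\<in>Basis. unit_character (x \<bullet> b) (\<xi> \<bullet> b))"
  by (simp add: unit_character_def euclidean_inner[of x \<xi>] sum_distrib_left exp_sum)

text \<open>Gaussian and character both factor over the coordinates, so the integral is a product of
  one-dimensional ones.\<close>

lemma gauss_fourier:
  fixes x :: "'a::euclidean_space"
  assumes t: "0 < t"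
  shows "has_bochner_integral lborel (\<lambda>\<xi>. complex_of_real (gauss (1 / t) \<xi>) * unit_character x \<xi>)
           (complex_of_real (t ^ DIM('a) * gauss t x))"
proof -
  interpret product_sigma_finite "\<lambda>_::'a. lborel :: real measure" ..
  let ?h = "\<lambda>b s. complex_of_real (gauss (1 / t) (s::real)) * unit_character (x \<bullet> b) s"
  have h: "integrable lborel (?h b)" "integral\<^sup>L lborel (?h b) = complex_of_real (t * gauss t (x \<bullet> b))" for b
    using gauss_fourier_real[OF t, of "x \<bullet> b"] by (auto simp: has_bochner_integral_iff)
  have coord: "(\<Sum>b\<in>Basis. f b *\<^sub>R b) \<bullet> c = f c" if "c \<in> Basis" for f and c :: 'a
    using that by (simp add: inner_sum_left inner_Basis if_distrib cong: if_cong)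
  let ?T = "\<lambda>f. (\<Sum>b\<in>Basis. f b *\<^sub>R b) :: 'a"
  let ?F = "\<lambda>\<xi>. complex_of_real (gauss (1 / t) \<xi>) * unit_character x \<xi>"
  have F: "?F (?T f) = (\<Prod>b\<in>Basis. ?h b (f b))" for f
    unfolding gauss_prod[of _ "?T f"] unit_character_prod[of _ "?T f"] of_real_prod prod.distrib
    by (intro arg_cong2[where f="(*)"] prod.cong refl) (simp_all only: coord)
  have 1: "integrable (\<Pi>\<^sub>M b\<in>(Basis::'a set). lborel) (\<lambda>f. ?F (?T f))"
    unfolding F by (intro product_integrable_prod h finite_Basis)
  have "(\<integral>f. ?F (?T f) \<partial>(\<Pi>\<^sub>M b\<in>(Basis::'a set). lborel)) = (\<Prod>b\<in>(Basis::'a set). complex_of_real (t * gauss t (x \<bullet> b)))"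
    unfolding F by (subst product_integral_prod) (auto simp: h)
  also have "\<dots> = complex_of_real (t ^ DIM('a) * gauss t x)"
    unfolding gauss_prod[of t x] by (simp add: prod.distrib)
  finally have 2: "(\<integral>f. ?F (?T f) \<partial>(\<Pi>\<^sub>M b\<in>(Basis::'a set). lborel)) = complex_of_real (t ^ DIM('a) * gauss t x)" .
  \<comment> \<open>\<open>lborel_eq\<close> presents \<open>lborel\<close> as the image of the
    product measure under the map \<open>?T\<close>; both facts are transported along it.\<close>
  show ?thesis
    unfolding has_bochner_integral_iff
    by (subst (1 2) lborel_eq, subst integrable_distr_eq, simp, simp, subst integral_distr, simp, simp)
       (use 1 2 in simp)
qed

corollary gauss_integral:
  assumes t: "0 < t"
  shows "has_bochner_integral lborel (gauss (1 / t) :: 'a::euclidean_space \<Rightarrow> real) (t ^ DIM('a))"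
proof -
  have "has_bochner_integral lborel (\<lambda>\<xi>::'a. complex_of_real (gauss (1 / t) \<xi>)) (complex_of_real (t ^ DIM('a)))"
    using gauss_fourier[OF t, of "0::'a"] by (simp add: gauss_def unit_character_def)
  from has_bochner_integral_Re[OF this] show ?thesis by simp
qed

text \<open>The Gaussian of \<open>X \<omega>\<close> is written as a Fourier integral and the order
  of integration is exchanged. The joint integrand is dominated by
  \<open>B * gauss (1 / t) \<xi>\<close>, which is integrable because \<open>P\<close> is finite.
  The weight \<open>w\<close> will be a cutoff, a second Gaussian or a character.\<close>

lemma weighted_gauss_fourier:
  fixes X :: "'b \<Rightarrow> 'a::euclidean_space" and w :: "'b \<Rightarrow> complex"
  assumes "finite_measure P" and X[measurable]: "X \<in> borel_measurable P"
    and w[measurable]: "w \<in> borel_measurable P" and B: "\<And>\<omega>. norm (w \<omega>) \<le> B" and t: "0 < t"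
  shows "integrable lborel (\<lambda>\<xi>. complex_of_real (gauss (1 / t) \<xi>) * (LINT \<omega>|P. w \<omega> * unit_character (X \<omega>) \<xi>))"
    and "(LINT \<omega>|P. w \<omega> * complex_of_real (t ^ DIM('a) * gauss t (X \<omega>)))
      = (LBINT \<xi>. complex_of_real (gauss (1 / t) \<xi>) * (LINT \<omega>|P. w \<omega> * unit_character (X \<omega>) \<xi>))"
proof -
  interpret P: finite_measure P by fact
  interpret pair_sigma_finite P "lborel :: 'a measure" ..
  let ?f = "\<lambda>\<omega> \<xi>. w \<omega> * (complex_of_real (gauss (1 / t) \<xi>) * unit_character (X \<omega>) \<xi>)"
  have int: "integrable (P \<Otimes>\<^sub>M lborel) (case_prod ?f)"
  proof (rule Bochner_Integration.integrable_bound)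
    show "integrable (P \<Otimes>\<^sub>M lborel) (\<lambda>(\<omega>, \<xi>). B * gauss (1 / t) (\<xi>::'a))"
      using gauss_integral[OF t] P.emeasure_finite
      by (intro integrable_mult_right Fubini_integrable)
        (auto simp: case_prod_beta has_bochner_integral_iff gauss_pos less_imp_le)
    have "norm (w \<omega>) * gauss (1 / t) \<xi> \<le> B * gauss (1 / t) \<xi>" for \<omega> \<xi>
      by (intro mult_right_mono B) (simp add: gauss_pos less_imp_le)
    hence "norm (case_prod ?f z) \<le> norm (case_prod (\<lambda>\<omega> \<xi>. B * gauss (1 / t) \<xi>) z)" for z
      by (cases z) (use gauss_pos[of "1 / t" "snd z"] in
        \<open>force simp: norm_mult intro: order_trans[OF _ abs_ge_self]\<close>)
    thus "AE z in P \<Otimes>\<^sub>M lborel. norm (case_prod ?f z) \<le> norm (case_prod (\<lambda>\<omega> \<xi>. B * gauss (1 / t) \<xi>) z)"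
      by simp
  qed measurable
  have inner: "(LINT \<omega>|P. ?f \<omega> \<xi>)
     = complex_of_real (gauss (1 / t) \<xi>) * (LINT \<omega>|P. w \<omega> * unit_character (X \<omega>) \<xi>)" for \<xi>
    unfolding integral_mult_right_zero[symmetric] by (simp add: mult_ac)
  show "integrable lborel (\<lambda>\<xi>. complex_of_real (gauss (1 / t) \<xi>) * (LINT \<omega>|P. w \<omega> * unit_character (X \<omega>) \<xi>))"
    using integrable_snd[OF int] unfolding inner .
  have "(LBINT \<xi>. ?f \<omega> \<xi>) = w \<omega> * complex_of_real (t ^ DIM('a) * gauss t (X \<omega>))" for \<omega>
    using gauss_fourier[OF t, of "X \<omega>"] by (simp add: has_bochner_integral_iff)
  thus "(LINT \<omega>|P. w \<omega> * complex_of_real (t ^ DIM('a) * gauss t (X \<omega>)))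
      = (LBINT \<xi>. complex_of_real (gauss (1 / t) \<xi>) * (LINT \<omega>|P. w \<omega> * unit_character (X \<omega>) \<xi>))"
    using Fubini_integral[OF int] unfolding inner by (simp only:)
qed

lemma integral_pair_mult:
  fixes f :: "'a \<Rightarrow> complex" and g :: "'b \<Rightarrow> complex"
  assumes "sigma_finite_measure M" "sigma_finite_measure N"
    and f: "integrable M f" and g: "integrable N g"
  shows "integrable (M \<Otimes>\<^sub>M N) (\<lambda>z. f (fst z) * g (snd z))"
    and "(LINT z|(M \<Otimes>\<^sub>M N). f (fst z) * g (snd z)) = integral\<^sup>L M f * integral\<^sup>L N g"
proof -
  interpret M: sigma_finite_measure M by fact
  interpret N: sigma_finite_measure N by fact
  interpret pair_sigma_finite M N ..
  have [measurable]: "f \<in> borel_measurable M" "g \<in> borel_measurable N" using f g by auto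
  show int: "integrable (M \<Otimes>\<^sub>M N) (\<lambda>z. f (fst z) * g (snd z))"
    using f g by (intro Fubini_integrable) (auto simp: norm_mult)
  show "(LINT z|(M \<Otimes>\<^sub>M N). f (fst z) * g (snd z)) = integral\<^sup>L M f * integral\<^sup>L N g"
    using integral_fst'[OF int] by simp
qed

section \<open>Energies of quadruples and their Fourier representation\<close>

text \<open>Quadruples are nested as \<open>((a, b), (c, d))\<close>, so that integrals of products
  split first into the pairs and then into single points.\<close>

definition quad_measure :: "'a measure \<Rightarrow> (('a \<times> 'a) \<times> ('a \<times> 'a)) measure" where
  "quad_measure \<mu> = (\<mu> \<Otimes>\<^sub>M \<mu>) \<Otimes>\<^sub>M (\<mu> \<Otimes>\<^sub>M \<mu>)"

definition pair_diff :: "('a::euclidean_space \<times> 'a) \<times> ('a \<times> 'a) \<Rightarrow> 'a" where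
  "pair_diff \<omega> = fst (fst \<omega>) - snd (fst \<omega>)"

text \<open>This vanishes exactly when \<open>a - b = c - d\<close>, that is, when
  \<open>b, a, d, c\<close> is a possibly degenerate parallelogram
  \<open>x, x + y, x + z, x + y + z\<close>.\<close>

definition alt_sum :: "('a::euclidean_space \<times> 'a) \<times> ('a \<times> 'a) \<Rightarrow> 'a" where
  "alt_sum \<omega> = fst (fst \<omega>) - snd (fst \<omega>) - fst (snd \<omega>) + snd (snd \<omega>)"

lemma finite_measure_quad: "finite_measure \<mu> \<Longrightarrow> finite_measure (quad_measure \<mu>)"
  unfolding quad_measure_def by (intro finite_measure_pair_measure)

lemma sets_quad [measurable_cong]:
  "sets (quad_measure \<mu>) = sets ((\<mu> \<Otimes>\<^sub>M \<mu>) \<Otimes>\<^sub>M (\<mu> \<Otimes>\<^sub>M \<mu>))"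
  by (simp add: quad_measure_def)

lemma measurable_quad:
  assumes \<mu>[measurable_cong]: "sets \<mu> = sets (borel :: 'a::euclidean_space measure)"
  shows "pair_diff \<in> borel_measurable (quad_measure \<mu>)" "alt_sum \<in> borel_measurable (quad_measure \<mu>)"
  unfolding pair_diff_def[abs_def] alt_sum_def[abs_def] by measurable

text \<open>The conjugates follow the signs in \<open>alt_sum\<close>: the pair
  \<open>(a, b)\<close> gives an integral times its conjugate, and so does \<open>(c, d)\<close>.
  Two functions are allowed since the pairs will carry different cutoffs or frequencies.\<close>

lemma integral_quad_product:
  fixes p q :: "'a \<Rightarrow> complex"
  assumes "finite_measure \<mu>" and p[measurable]: "p \<in> borel_measurable \<mu>"
    and q[measurable]: "q \<in> borel_measurable \<mu>"
    and "\<And>x. norm (p x) \<le> 1" "\<And>x. norm (q x) \<le> 1"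
  shows "(LINT \<omega>|quad_measure \<mu>. p (fst (fst \<omega>)) * cnj (p (snd (fst \<omega>))) * cnj (q (fst (snd \<omega>))) * q (snd (snd \<omega>)))
    = complex_of_real ((norm (LINT x|\<mu>. p x))\<^sup>2 * (norm (LINT x|\<mu>. q x))\<^sup>2)"
proof -
  interpret \<mu>: finite_measure \<mu> by fact
  interpret \<mu>\<mu>: finite_measure "\<mu> \<Otimes>\<^sub>M \<mu>" by (intro finite_measure_pair_measure assms)
  have int: "integrable \<mu> p" "integrable \<mu> q" "integrable \<mu> (\<lambda>x. cnj (p x))" "integrable \<mu> (\<lambda>x. cnj (q x))"
    using assms by (auto intro!: \<mu>.integrable_const_bound[where B=1])
  note pp = integral_pair_mult[OF \<mu>.sigma_finite_measure_axioms \<mu>.sigma_finite_measure_axioms int(1,3)]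
  note qq = integral_pair_mult[OF \<mu>.sigma_finite_measure_axioms \<mu>.sigma_finite_measure_axioms int(4,2)]
  have "(LINT \<omega>|quad_measure \<mu>. (p (fst (fst \<omega>)) * cnj (p (snd (fst \<omega>)))) * (cnj (q (fst (snd \<omega>))) * q (snd (snd \<omega>))))
     = (integral\<^sup>L \<mu> p * cnj (integral\<^sup>L \<mu> p)) * (cnj (integral\<^sup>L \<mu> q) * integral\<^sup>L \<mu> q)"
    unfolding quad_measure_def
    using integral_pair_mult(2)[OF \<mu>\<mu>.sigma_finite_measure_axioms \<mu>\<mu>.sigma_finite_measure_axioms pp(1) qq(1)]
      pp(2) qq(2) by simp
  also have "\<dots> = complex_of_real ((norm (LINT x|\<mu>. p x))\<^sup>2 * (norm (LINT x|\<mu>. q x))\<^sup>2)"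
    unfolding of_real_mult complex_norm_square by (simp add: mult_ac)
  finally show ?thesis by (simp add: mult_ac)
qed

lemma fourier_measure_eq: "fourier_measure \<mu> \<xi> = (LINT x|\<mu>. unit_character x \<xi>)"
  by (simp add: fourier_measure_def unit_character_def)

text \<open>On the Fourier side the energy is the integral of \<open>gauss (1 / t)\<close> against a
  nonnegative \<open>F\<close> that does not depend on \<open>t\<close>. Since
  \<open>gauss (1 / t)\<close> grows with \<open>t\<close>, the energy at \<open>t = 1\<close> is a
  lower bound.\<close>

lemma localized_energy:
  fixes \<mu> :: "'a::euclidean_space measure"
  assumes fin: "finite_measure \<mu>" and \<mu>[measurable_cong]: "sets \<mu> = sets borel"
    and K[measurable]: "K\<^sub>1 \<in> sets borel" "K\<^sub>2 \<in> sets borel"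
    and pos: "emeasure \<mu> K\<^sub>1 > 0" "emeasure \<mu> K\<^sub>2 > 0"
  shows "\<exists>c>0. \<forall>t\<ge>1. c \<le> (LINT \<omega>|quad_measure \<mu>.
     indicator ((K\<^sub>1 \<times> K\<^sub>1) \<times> (K\<^sub>2 \<times> K\<^sub>2)) \<omega> * (t ^ DIM('a) * gauss t (alt_sum \<omega>)))"
proof -
  interpret \<mu>: finite_measure \<mu> by fact
  interpret \<mu>\<mu>: finite_measure "\<mu> \<Otimes>\<^sub>M \<mu>" by (intro finite_measure_pair_measure fin)
  interpret P: finite_measure "quad_measure \<mu>" by (rule finite_measure_quad[OF fin])
  define S where "S = (K\<^sub>1 \<times> K\<^sub>1) \<times> (K\<^sub>2 \<times> K\<^sub>2)"
  note [measurable] = measurable_quad[OF \<mu>]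
  have S[measurable]: "S \<in> sets (quad_measure \<mu>)" 
    unfolding S_def quad_measure_def using K \<mu> by (intro pair_measureI) auto
  define Q where "Q t = (LINT \<omega>|quad_measure \<mu>. indicator S \<omega> * (t ^ DIM('a) * gauss t (alt_sum \<omega>)))" for t
  define F where "F \<xi> = (norm (LINT x|\<mu>. indicator K\<^sub>1 x * unit_character x \<xi>))\<^sup>2
     * (norm (LINT x|\<mu>. indicator K\<^sub>2 x * unit_character x \<xi>))\<^sup>2" for \<xi>
  \<comment> \<open>The indicator of \<open>S\<close> is a product of four real indicators, so each
    can be absorbed into the character of its own variable.\<close>
  have inner: "(LINT \<omega>|quad_measure \<mu>. indicator S \<omega> * unit_character (alt_sum \<omega>) \<xi>) = complex_of_real (F \<xi>)" for \<xi>
    unfolding F_def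
    by (subst integral_quad_product[OF fin, symmetric])
       (auto simp: S_def alt_sum_def unit_character_diff_left unit_character_add_left norm_mult
          indicator_def intro!: Bochner_Integration.integral_cong)
  have Q: "integrable lborel (\<lambda>\<xi>. gauss (1 / t) \<xi> * F \<xi>)" "Q t = (LBINT \<xi>. gauss (1 / t) \<xi> * F \<xi>)"
    if t: "0 < t" for t
  proof -
    have B: "norm (indicator S \<omega> :: complex) \<le> 1" for \<omega> by (simp add: indicator_def)
    have w: "(\<lambda>\<omega>. indicator S \<omega> :: complex) \<in> borel_measurable (quad_measure \<mu>)" by measurable
    note * = weighted_gauss_fourier[OF P.finite_measure_axioms measurable_quad(2)[OF \<mu>] w B t, unfolded inner]
    have "integrable lborel (\<lambda>\<xi>. complex_of_real (gauss (1 / t) \<xi> * F \<xi>))" using *(1) by simp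
    thus "integrable lborel (\<lambda>\<xi>. gauss (1 / t) \<xi> * F \<xi>)" by (simp only: complex_of_real_integrable_eq)
    have "(LINT \<omega>|quad_measure \<mu>. complex_of_real (indicator S \<omega> * (t ^ DIM('a) * gauss t (alt_sum \<omega>))))
      = (LBINT \<xi>. complex_of_real (gauss (1 / t) \<xi> * F \<xi>))"
      using *(2) by (simp add: of_real_indicator)
    thus "Q t = (LBINT \<xi>. gauss (1 / t) \<xi> * F \<xi>)"
      unfolding integral_complex_of_real Q_def of_real_eq_iff .
  qed
  have "Q 1 \<le> Q t" if "1 \<le> t" for t
  proof -
    have "0 \<le> F \<xi>" for \<xi> by (simp add: F_def)
    thus ?thesis using that by (auto simp: Q intro!: integral_mono Q(1)[of 1, simplified] Q(1)[of t] mult_right_mono gauss_mono)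
  qed
  \<comment> \<open>Positivity is read off before taking transforms: the Gaussian is positive
    everywhere and \<open>S\<close> has positive measure.\<close>
  moreover have "0 < Q 1"
  proof -
    have int: "integrable (quad_measure \<mu>) (\<lambda>\<omega>. indicator S \<omega> * gauss 1 (alt_sum \<omega>))"
      by (intro P.integrable_const_bound[where B=1])
        (auto simp: indicator_def gauss_le_1 gauss_pos abs_of_pos)
    have "Q 1 \<noteq> 0"
    proof
      assume "Q 1 = 0"
      hence "AE \<omega> in quad_measure \<mu>. indicator S \<omega> * gauss 1 (alt_sum \<omega>) = 0"
        using integral_nonneg_eq_0_iff_AE[OF int] by (simp add: Q_def gauss_pos less_imp_le)
      hence "AE \<omega> in quad_measure \<mu>. \<omega> \<notin> S"
        by eventually_elim (use gauss_pos in \<open>auto simp: indicator_def less_le split: if_splits\<close>)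
      hence "emeasure (quad_measure \<mu>) S = 0"
        using S AE_iff_measurable[of S "quad_measure \<mu>" "\<lambda>\<omega>. \<omega> \<notin> S"] sets.sets_into_space[OF S] by auto
      moreover have "emeasure (quad_measure \<mu>) S
         = (emeasure \<mu> K\<^sub>1 * emeasure \<mu> K\<^sub>1) * (emeasure \<mu> K\<^sub>2 * emeasure \<mu> K\<^sub>2)"
        unfolding S_def quad_measure_def
        using K \<mu> by (subst \<mu>\<mu>.emeasure_pair_measure_Times | subst \<mu>.emeasure_pair_measure_Times | auto)+
      ultimately show False using pos by auto
    qed
    moreover have "0 \<le> Q 1"
      unfolding Q_def by (intro Bochner_Integration.integral_nonneg) (simp add: gauss_pos less_imp_le)
    ultimately show ?thesis by simp
  qed
  ultimately show ?thesis unfolding Q_def S_def by blast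
qed

text \<open>A function that is not integrable has Bochner integral 0, so no integrability has to be
  assumed.\<close>

lemma norm_integral_le_nn_integral:
  fixes f :: "'a \<Rightarrow> 'b::{banach, second_countable_topology}"
  shows "ennreal (norm (integral\<^sup>L M f)) \<le> (\<integral>\<^sup>+x. norm (f x) \<partial>M)"
  using integral_norm_bound_ennreal[of M f] by (cases "integrable M f") (auto simp: not_integrable_integral_eq)

text \<open>Both Gaussians are expanded, with frequency \<open>\<xi>\<close> for
  \<open>alt_sum\<close> and \<open>\<eta>\<close> for \<open>pair_diff\<close>. The phases add up
  to \<open>(a - b) \<bullet> (\<xi> + \<eta>) - (c - d) \<bullet> \<xi>\<close>, which produces the
  correlation on the right. Bounding \<open>gauss (1 / t) \<xi>\<close> by 1 removes
  \<open>t\<close>. The bound is in \<open>ennreal\<close> because no decay is assumed yet and it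
  may be infinite.\<close>

lemma diagonal_energy_le:
  fixes \<mu> :: "'a::euclidean_space measure"
  assumes fin: "finite_measure \<mu>" and \<mu>[measurable_cong]: "sets \<mu> = sets borel"
    and t: "0 < t" and r: "0 < r"
  shows "ennreal (r ^ DIM('a) * (LINT \<omega>|quad_measure \<mu>. gauss r (pair_diff \<omega>) * (t ^ DIM('a) * gauss t (alt_sum \<omega>))))
    \<le> (\<integral>\<^sup>+\<xi>. \<integral>\<^sup>+\<eta>. ennreal (gauss (1 / r) \<eta> * ((norm (fourier_measure \<mu> (\<xi> + \<eta>)))\<^sup>2 * (norm (fourier_measure \<mu> \<xi>))\<^sup>2)) \<partial>lborel \<partial>lborel)"
proof -
  interpret P: finite_measure "quad_measure \<mu>" by (rule finite_measure_quad[OF fin])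
  note [measurable] = measurable_quad[OF \<mu>]
  define F where "F \<xi> \<eta> = (norm (fourier_measure \<mu> (\<xi> + \<eta>)))\<^sup>2 * (norm (fourier_measure \<mu> \<xi>))\<^sup>2" for \<xi> \<eta>
  define w where "w \<omega> = complex_of_real (r ^ DIM('a) * gauss r (pair_diff \<omega>))" for \<omega> :: "('a \<times> 'a) \<times> ('a \<times> 'a)"
  have w: "w \<in> borel_measurable (quad_measure \<mu>)" "norm (w \<omega>) \<le> r ^ DIM('a)" for \<omega>
    unfolding w_def[abs_def] using r by (auto simp: norm_mult gauss_le_1 gauss_pos abs_of_pos norm_power)
  have inner: "(LINT \<omega>|quad_measure \<mu>. unit_character (alt_sum \<omega>) \<xi> * unit_character (pair_diff \<omega>) \<eta>)
     = complex_of_real (F \<xi> \<eta>)" for \<xi> \<eta>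
    unfolding F_def fourier_measure_eq
    by (subst integral_quad_product[OF fin, symmetric])
       (auto simp: alt_sum_def pair_diff_def unit_character_diff_left unit_character_add_left
          unit_character_add_right norm_mult mult_ac intro!: Bochner_Integration.integral_cong)
  \<comment> \<open>Expansion in \<open>\<eta>\<close>: here the character of \<open>alt_sum\<close>
    plays the part of the weight.\<close>
  have mid: "(LINT \<omega>|quad_measure \<mu>. w \<omega> * unit_character (alt_sum \<omega>) \<xi>)
     = (LBINT \<eta>. complex_of_real (gauss (1 / r) \<eta> * F \<xi> \<eta>))" for \<xi>
  proof -
    have m: "(\<lambda>\<omega>. unit_character (alt_sum \<omega>) \<xi>) \<in> borel_measurable (quad_measure \<mu>)" by measurable
    show ?thesis
      using weighted_gauss_fourier(2)[OF P.finite_measure_axioms measurable_quad(1)[OF \<mu>] m _ r, of 1]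
      unfolding inner w_def by (simp add: mult_ac)
  qed
  have "complex_of_real (r ^ DIM('a) * (LINT \<omega>|quad_measure \<mu>. gauss r (pair_diff \<omega>) * (t ^ DIM('a) * gauss t (alt_sum \<omega>))))
     = (LINT \<omega>|quad_measure \<mu>. w \<omega> * complex_of_real (t ^ DIM('a) * gauss t (alt_sum \<omega>)))"
    unfolding w_def of_real_mult[symmetric] integral_complex_of_real
    by (simp add: mult.assoc)
  \<comment> \<open>Expansion in \<open>\<xi>\<close>: now the weight is \<open>w\<close>, the
    Gaussian of \<open>pair_diff\<close>.\<close>
  also have "\<dots> = (LBINT \<xi>. complex_of_real (gauss (1 / t) \<xi>) * (LBINT \<eta>. complex_of_real (gauss (1 / r) \<eta> * F \<xi> \<eta>)))"
    using weighted_gauss_fourier(2)[OF P.finite_measure_axioms measurable_quad(2)[OF \<mu>] w t] unfolding mid .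
  also have "\<dots> = complex_of_real (LBINT \<xi>. gauss (1 / t) \<xi> * (LBINT \<eta>. gauss (1 / r) \<eta> * F \<xi> \<eta>))"
    by (simp only: integral_complex_of_real of_real_mult[symmetric])
  finally have "r ^ DIM('a) * (LINT \<omega>|quad_measure \<mu>. gauss r (pair_diff \<omega>) * (t ^ DIM('a) * gauss t (alt_sum \<omega>)))
     = (LBINT \<xi>. gauss (1 / t) \<xi> * (LBINT \<eta>. gauss (1 / r) \<eta> * F \<xi> \<eta>))"
    unfolding of_real_eq_iff .
  also have "ennreal \<dots> \<le> (\<integral>\<^sup>+\<xi>. norm (gauss (1 / t) \<xi> * (LBINT \<eta>. gauss (1 / r) \<eta> * F \<xi> \<eta>)) \<partial>lborel)"
    by (rule order_trans[OF _ norm_integral_le_nn_integral]) (auto intro: ennreal_leI)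
  also have "\<dots> \<le> (\<integral>\<^sup>+\<xi>. \<integral>\<^sup>+\<eta>. norm (gauss (1 / r) \<eta> * F \<xi> \<eta>) \<partial>lborel \<partial>lborel)"
  proof (rule nn_integral_mono)
    fix \<xi> :: 'a
    have "norm (gauss (1 / t) \<xi> * (LBINT \<eta>. gauss (1 / r) \<eta> * F \<xi> \<eta>)) \<le> norm (LBINT \<eta>. gauss (1 / r) \<eta> * F \<xi> \<eta>)"
      using gauss_pos[of "1 / t" \<xi>] by (auto simp: abs_mult gauss_le_1 intro!: mult_left_le_one_le)
    thus "ennreal (norm (gauss (1 / t) \<xi> * (LBINT \<eta>. gauss (1 / r) \<eta> * F \<xi> \<eta>)))
       \<le> (\<integral>\<^sup>+\<eta>. norm (gauss (1 / r) \<eta> * F \<xi> \<eta>) \<partial>lborel)"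
      by (intro order_trans[OF ennreal_leI norm_integral_le_nn_integral])
  qed
  also have "\<dots> = (\<integral>\<^sup>+\<xi>. \<integral>\<^sup>+\<eta>. ennreal (gauss (1 / r) \<eta> * F \<xi> \<eta>) \<partial>lborel \<partial>lborel)"
    by (intro nn_integral_cong) (simp add: F_def gauss_pos less_imp_le)
  finally show ?thesis unfolding F_def .
qed

section \<open>Integrals of polynomially decaying weights\<close>

lemma nn_integral_powr_finite:
  assumes p: "real DIM('a::euclidean_space) < p"
  shows "(\<integral>\<^sup>+(\<xi>::'a). ennreal ((1 + norm \<xi>) powr (- p)) \<partial>lborel) < \<infinity>"
proof -
  define V where "V = measure lborel (cball (0::'a) 1)"
  \<comment> \<open>The ratio of the geometric series below: each dyadic step multiplies the volume
    by \<open>2 ^ n\<close> and the weight by \<open>2 powr (- p)\<close>.\<close>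
  define q where "q = 2 powr (real DIM('a) - p)"
  have q: "0 \<le> q" "q < 1" using p powr_less_mono[of "real DIM('a) - p" 0 2] by (auto simp: q_def)
  \<comment> \<open>Dyadic decomposition: the summand with \<open>2 ^ k \<le> 1 + |\<xi>| < 2 ^ (k + 1)\<close> alone dominates.\<close>
  have le: "ennreal ((1 + norm \<xi>) powr (- p))
      \<le> (\<Sum>k. ennreal ((2 ^ k) powr (- p)) * indicator (cball 0 (2 ^ Suc k)) \<xi>)" for \<xi> :: 'a
  proof -
    obtain k where k: "2 ^ k \<le> 1 + norm \<xi>" "1 + norm \<xi> < 2 ^ (k + 1)"
    proof -
      have "1 \<le> nat \<lfloor>1 + norm \<xi>\<rfloor>" by (simp add: le_nat_iff le_floor_iff)
      then obtain k where k: "2 ^ k \<le> nat \<lfloor>1 + norm \<xi>\<rfloor>" "nat \<lfloor>1 + norm \<xi>\<rfloor> < 2 ^ (k + 1)"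
        using ex_power_ivl1[of 2 "nat \<lfloor>1 + norm \<xi>\<rfloor>"] by auto
      have "real (2 ^ k) \<le> real (nat \<lfloor>1 + norm \<xi>\<rfloor>)" using k(1) by (simp only: of_nat_le_iff)
      also have "\<dots> \<le> 1 + norm \<xi>" by (rule of_nat_floor) simp
      finally have "2 ^ k \<le> 1 + norm \<xi>" by simp
      moreover have "1 + norm \<xi> < real (Suc (nat \<lfloor>1 + norm \<xi>\<rfloor>))" by linarith
      moreover have "real (Suc (nat \<lfloor>1 + norm \<xi>\<rfloor>)) \<le> real (2 ^ (k + 1))"
        using k(2) by (simp only: of_nat_le_iff Suc_le_eq)
      ultimately show ?thesis using that[of k] by simp
    qed
    have "ennreal ((1 + norm \<xi>) powr (- p)) \<le> ennreal ((2 ^ k) powr (- p))"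
      using k p by (intro ennreal_leI powr_mono2') auto
    also have "\<dots> = (\<Sum>k\<in>{k}. ennreal ((2 ^ k) powr (- p)) * indicator (cball 0 (2 ^ Suc k)) \<xi>)"
      using k by simp
    also have "\<dots> \<le> (\<Sum>k. ennreal ((2 ^ k) powr (- p)) * indicator (cball 0 (2 ^ Suc k)) \<xi>)"
      by (intro sum_le_suminf) auto
    finally show ?thesis .
  qed
  have ball: "emeasure lborel (cball (0::'a) (2 ^ Suc k)) = ennreal (V * (2 ^ Suc k) ^ DIM('a))" for k
    by (simp add: V_def emeasure_cball content_cball)
  have "(\<integral>\<^sup>+(\<xi>::'a). ennreal ((1 + norm \<xi>) powr (- p)) \<partial>lborel)
     \<le> (\<integral>\<^sup>+(\<xi>::'a). (\<Sum>k. ennreal ((2 ^ k) powr (- p)) * indicator (cball 0 (2 ^ Suc k)) \<xi>) \<partial>lborel)"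
    by (intro nn_integral_mono le)
  also have "\<dots> = (\<Sum>k. ennreal ((2 ^ k) powr (- p)) * ennreal (V * (2 ^ Suc k) ^ DIM('a)))"
  proof (subst nn_integral_suminf)
    show "(\<lambda>\<xi>::'a. ennreal ((2 ^ k) powr (- p)) * indicator (cball 0 (2 ^ Suc k)) \<xi>) \<in> borel_measurable lborel" for k
      by (intro borel_measurable_times_ennreal borel_measurable_indicator) (auto simp del: power_Suc)
  qed (simp add: nn_integral_cmult_indicator ball del: power_Suc)
  also have "\<dots> = (\<Sum>k. ennreal (V * 2 ^ DIM('a) * q ^ k))"
  proof (intro suminf_cong)
    fix k :: nat
    have "(2 ^ k) powr (- p) * (2 ^ Suc k) ^ DIM('a) = 2 ^ DIM('a) * q ^ k"
      by (simp add: q_def powr_realpow[symmetric] powr_powr powr_add[symmetric] power_mult[symmetric] 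
         power_mult_distrib powr_power algebra_simps)
    thus "ennreal ((2 ^ k) powr (- p)) * ennreal (V * (2 ^ Suc k) ^ DIM('a)) = ennreal (V * 2 ^ DIM('a) * q ^ k)"
      by (subst ennreal_mult[symmetric]) (simp_all add: V_def mult_ac)
  qed
  also have "\<dots> = ennreal (\<Sum>k. V * 2 ^ DIM('a) * q ^ k)"
    using q by (intro suminf_ennreal2) (auto simp: V_def intro!: summable_mult summable_geometric)
  also have "\<dots> < \<infinity>" by simp
  finally show ?thesis .
qed

text \<open>\<open>gauss (1 / r)\<close> has total mass \<open>r ^ n\<close>, so this says that a
  Gaussian average of the weight at scale \<open>r\<close> can be made small. A fixed ball
  contributes at most its volume, negligible against \<open>r ^ n\<close>; outside it the weight
  itself is small.\<close>

lemma gauss_powr_small: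
  assumes s: "0 < s" and e: "0 < e"
  shows "\<exists>r>0. (\<integral>\<^sup>+(\<eta>::'a::euclidean_space). ennreal (gauss (1 / r) \<eta> * (1 + norm \<eta>) powr (- s)) \<partial>lborel)
     \<le> ennreal (e * r ^ DIM('a))"
proof -
  \<comment> \<open>The solution of \<open>R powr (- s) = e / 2\<close>.\<close>
  define R where "R = (e / 2) powr (- 1 / s)"
  have R: "0 < R" using e by (simp add: R_def)
  have decay: "(1 + norm \<eta>) powr (- s) \<le> e / 2" if "R < norm \<eta>" for \<eta> :: 'a
  proof -
    have "(1 + norm \<eta>) powr (- s) \<le> R powr (- s)"
      using that R s by (intro powr_mono2') auto
    also have "\<dots> = e / 2" using s e by (simp add: R_def powr_powr)
    finally show ?thesis .
  qed
  define V where "V = measure lborel (cball (0::'a) R)"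
  have V: "emeasure lborel (cball (0::'a) R) = ennreal V"
    unfolding V_def using emeasure_eq_ennreal_measure[of lborel "cball (0::'a) R"]
      emeasure_bounded_finite[of "cball (0::'a) R"] by simp
  \<comment> \<open>The second entry gives \<open>V \<le> e / 2 * r\<close>; the first gives
    \<open>r \<le> r ^ n\<close>.\<close>
  define r where "r = max 1 (2 * V / e)"
  have r: "1 \<le> r" "2 * V / e \<le> r" by (simp_all add: r_def)
  have "V \<le> e / 2 * r" using r e by (simp add: field_simps)
  also have "r \<le> r ^ DIM('a)" using r by (simp add: self_le_power)
  finally have Vr: "V \<le> e / 2 * r ^ DIM('a)" using e by simp
  have "(\<integral>\<^sup>+(\<eta>::'a). ennreal (gauss (1 / r) \<eta> * (1 + norm \<eta>) powr (- s)) \<partial>lborel)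
     \<le> (\<integral>\<^sup>+(\<eta>::'a). indicator (cball 0 R) \<eta> + ennreal (e / 2 * gauss (1 / r) \<eta>) \<partial>lborel)"
  proof (rule nn_integral_mono)
    fix \<eta> :: 'a
    show "ennreal (gauss (1 / r) \<eta> * (1 + norm \<eta>) powr (- s))
       \<le> indicator (cball 0 R) \<eta> + ennreal (e / 2 * gauss (1 / r) \<eta>)"
    proof (cases "norm \<eta> \<le> R")
      case True
      have "(1 + norm \<eta>) powr (- s) \<le> 1"
        using s powr_mono2'[of "-s" 1 "1 + norm \<eta>"] by simp
      hence "gauss (1 / r) \<eta> * (1 + norm \<eta>) powr (- s) \<le> 1 * 1"
        by (intro mult_mono) (auto simp: gauss_le_1)
      hence "ennreal (gauss (1 / r) \<eta> * (1 + norm \<eta>) powr (- s)) \<le> 1"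
        by (simp add: ennreal_le_1)
      thus ?thesis using True by (auto intro: add_increasing2)
    next
      case False
      hence "gauss (1 / r) \<eta> * (1 + norm \<eta>) powr (- s) \<le> gauss (1 / r) \<eta> * (e / 2)"
        by (intro mult_left_mono decay) (auto simp: gauss_pos less_imp_le)
      thus ?thesis using False by (simp add: mult_ac ennreal_leI)
    qed
  qed
  also have "\<dots> = ennreal V + (\<integral>\<^sup>+(\<eta>::'a). ennreal (e / 2 * gauss (1 / r) \<eta>) \<partial>lborel)"
    by (subst nn_integral_add) (auto simp: V intro!: borel_measurable_indicator)
  also have "(\<integral>\<^sup>+(\<eta>::'a). ennreal (e / 2 * gauss (1 / r) \<eta>) \<partial>lborel) = ennreal (e / 2 * r ^ DIM('a))"
    using gauss_integral[of r, where 'a='a] r e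
    by (subst nn_integral_eq_integral) (auto simp: has_bochner_integral_iff gauss_pos less_imp_le)
  also have "ennreal V + \<dots> = ennreal (V + e / 2 * r ^ DIM('a))"
    using r e by (subst ennreal_plus) (auto simp: V_def)
  also have "\<dots> \<le> ennreal (e * r ^ DIM('a))"
    using Vr by (intro ennreal_leI) simp
  finally show ?thesis using r by (intro exI[of _ r]) simp
qed

section \<open>Smallness of the energy near the diagonal\<close>

text \<open>The correlation is bounded by a decaying weight in \<open>\<eta>\<close> times a
  function of \<open>\<xi>\<close> whose integral does not depend on \<open>\<eta>\<close>. Choosing
  \<open>r\<close> for the weight alone makes the estimate uniform in \<open>t\<close>.\<close>

lemma diagonal_energy_small:
  fixes \<mu> :: "'a::euclidean_space measure"
  assumes fin: "finite_measure \<mu>" and \<mu>[measurable_cong]: "sets \<mu> = sets borel"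
    and \<beta>: "real DIM('a) / 2 < \<beta>"
    and dec: "\<And>\<xi>. norm (fourier_measure \<mu> \<xi>) * (1 + norm \<xi>) powr (\<beta> / 2) \<le> C"
    and e: "0 < e"
  shows "\<exists>r>0. \<forall>t>0. (LINT \<omega>|quad_measure \<mu>. gauss r (pair_diff \<omega>) * (t ^ DIM('a) * gauss t (alt_sum \<omega>))) \<le> e"
proof -
  \<comment> \<open>Chosen so that \<open>\<beta> = s + p / 2\<close> with \<open>s > 0\<close> and
    \<open>p > n\<close>.\<close>
  define s where "s = (\<beta> - real DIM('a) / 2) / 2"
  define p where "p = \<beta> + real DIM('a) / 2"
  have s: "0 < s" and p: "real DIM('a) < p" and sp: "- \<beta> = - s + - p / 2"
    using \<beta> by (simp_all add: s_def p_def field_simps)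
  have C: "0 \<le> C" using order_trans[OF _ dec[of 0], of 0] by simp
  define W where "W = enn2real (\<integral>\<^sup>+(\<xi>::'a). ennreal ((1 + norm \<xi>) powr (- p)) \<partial>lborel)"
  have W: "(\<integral>\<^sup>+(\<xi>::'a). ennreal ((1 + norm \<xi>) powr (- p)) \<partial>lborel) = ennreal W"
    using nn_integral_powr_finite[OF p] by (simp add: W_def)
  have W0: "0 \<le> W" by (simp add: W_def)
  have sq: "(norm (fourier_measure \<mu> \<xi>))\<^sup>2 \<le> C\<^sup>2 * (1 + norm \<xi>) powr (- \<beta>)" for \<xi>
  proof -
    have "norm (fourier_measure \<mu> \<xi>) \<le> C * (1 + norm \<xi>) powr (- \<beta> / 2)"
      using dec[of \<xi>] norm_ge_zero[of \<xi>]
      by (simp add: powr_minus divide_inverse[symmetric] pos_le_divide_eq del: norm_ge_zero)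
    hence "(norm (fourier_measure \<mu> \<xi>))\<^sup>2 \<le> (C * (1 + norm \<xi>) powr (- \<beta> / 2))\<^sup>2"
      by (intro power_mono) auto
    also have "\<dots> = C\<^sup>2 * (1 + norm \<xi>) powr (- \<beta>)"
      by (simp add: power_mult_distrib power2_eq_square powr_add[symmetric])
    finally show ?thesis .
  qed
  let ?F = "\<lambda>\<xi> \<eta>. (norm (fourier_measure \<mu> (\<xi> + \<eta>)))\<^sup>2 * (norm (fourier_measure \<mu> \<xi>))\<^sup>2"
  \<comment> \<open>The surplus \<open>\<beta> - n/2\<close> is split: half of it buys decay in \<open>\<eta>\<close>, because
    \<open>(1 + |\<xi>|) (1 + |\<xi> + \<eta>|) \<ge> 1 + |\<eta>|\<close>, and half of it keeps integrability in \<open>\<xi>\<close>.\<close>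
  have bound: "?F \<xi> \<eta> \<le> C ^ 4 * (1 + norm \<eta>) powr (- s)
      * ((1 + norm \<xi>) powr (- p) + (1 + norm (\<xi> + \<eta>)) powr (- p))" for \<xi> \<eta>
  proof -
    define A B where "A = 1 + norm \<xi>" and "B = 1 + norm (\<xi> + \<eta>)"
    have AB: "1 \<le> A" "1 \<le> B" by (simp_all add: A_def B_def)
    have "norm \<eta> \<le> norm (\<xi> + \<eta>) + norm \<xi>"
      using norm_triangle_ineq4[of "\<xi> + \<eta>" \<xi>] by simp
    hence H: "1 + norm \<eta> \<le> A * B"
      using mult_nonneg_nonneg[OF norm_ge_zero norm_ge_zero, of \<xi> "\<xi> + \<eta>"]
      unfolding A_def B_def distrib_left distrib_right by linarith
    \<comment> \<open>The product is replaced by a sum so that each term can be integrated in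
      \<open>\<xi>\<close> separately.\<close>
    have amgm: "(A * B) powr (- p / 2) \<le> A powr (- p) + B powr (- p)"
    proof -
      define u v where "u = A powr (- p / 2)" and "v = B powr (- p / 2)"
      have "u\<^sup>2 = A powr (- p)" "v\<^sup>2 = B powr (- p)" "(A * B) powr (- p / 2) = u * v"
        using AB by (simp_all add: u_def v_def powr_power powr_mult)
      moreover have "u * v \<le> u\<^sup>2 + v\<^sup>2"
      proof -
        have "0 \<le> u * v" by (simp add: u_def v_def)
        thus ?thesis using sum_squares_bound[of u v] by linarith
      qed
      ultimately show ?thesis by simp
    qed
    have "?F \<xi> \<eta> \<le> (C\<^sup>2 * B powr (- \<beta>)) * (C\<^sup>2 * A powr (- \<beta>))"
      unfolding A_def B_def by (intro mult_mono sq) auto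
    also have "\<dots> = C ^ 4 * (A * B) powr (- \<beta>)"
      using AB by (simp add: powr_mult)
    also have "(A * B) powr (- \<beta>) = (A * B) powr (- s) * (A * B) powr (- p / 2)"
      unfolding sp by (rule powr_add)
    also have "\<dots> \<le> (1 + norm \<eta>) powr (- s) * (A powr (- p) + B powr (- p))"
      using H s by (intro mult_mono amgm powr_mono2') (auto simp: add_pos_nonneg)
    finally show ?thesis
      unfolding A_def B_def by (simp add: mult_left_mono mult.assoc)
  qed
  \<comment> \<open>The \<open>+ 1\<close> keeps the denominator positive even if
    \<open>C = 0\<close>.\<close>
  define e' where "e' = e / (2 * C ^ 4 * W + 1)"
  have den: "0 < 2 * C ^ 4 * W + 1" using W0 by (simp add: add_nonneg_pos)
  have e': "0 < e'" using e den by (simp add: e'_def)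
  obtain r where r: "0 < r"
    "(\<integral>\<^sup>+(\<eta>::'a). ennreal (gauss (1 / r) \<eta> * (1 + norm \<eta>) powr (- s)) \<partial>lborel) \<le> ennreal (e' * r ^ DIM('a))"
    using gauss_powr_small[OF s e', where 'a='a] by auto
  have "(LINT \<omega>|quad_measure \<mu>. gauss r (pair_diff \<omega>) * (t ^ DIM('a) * gauss t (alt_sum \<omega>))) \<le> e" (is "?J \<le> e")
    if t: "0 < t" for t
  proof -
    let ?g = "\<lambda>\<eta>::'a. gauss (1 / r) \<eta> * (1 + norm \<eta>) powr (- s)"
    let ?h = "\<lambda>\<xi>::'a. (1 + norm \<xi>) powr (- p)"
    have "ennreal (r ^ DIM('a) * ?J) \<le> (\<integral>\<^sup>+\<xi>. \<integral>\<^sup>+\<eta>. ennreal (gauss (1 / r) \<eta> * ?F \<xi> \<eta>) \<partial>lborel \<partial>lborel)"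
      by (rule diagonal_energy_le[OF fin \<mu> t r(1)])
    also have "\<dots> \<le> (\<integral>\<^sup>+\<xi>. \<integral>\<^sup>+\<eta>. ennreal (C ^ 4 * ?g \<eta> * (?h \<xi> + ?h (\<eta> + \<xi>))) \<partial>lborel \<partial>lborel)"
    proof (intro nn_integral_mono ennreal_leI)
      fix \<xi> \<eta> :: 'a
      have "gauss (1 / r) \<eta> * ?F \<xi> \<eta>
         \<le> gauss (1 / r) \<eta> * (C ^ 4 * (1 + norm \<eta>) powr (- s) * (?h \<xi> + ?h (\<xi> + \<eta>)))"
        by (intro mult_left_mono bound) (simp add: gauss_pos less_imp_le)
      thus "gauss (1 / r) \<eta> * ?F \<xi> \<eta> \<le> C ^ 4 * ?g \<eta> * (?h \<xi> + ?h (\<eta> + \<xi>))"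
        by (simp add: mult_ac add.commute)
    qed
    \<comment> \<open>With \<open>\<xi>\<close> as the inner variable, translation invariance gives
      both terms the same integral \<open>W\<close>.\<close>
    also have "\<dots> = (\<integral>\<^sup>+\<eta>. \<integral>\<^sup>+\<xi>. ennreal (C ^ 4 * ?g \<eta> * (?h \<xi> + ?h (\<eta> + \<xi>))) \<partial>lborel \<partial>lborel)"
      by (rule lborel_pair.Fubini') measurable
    also have "\<dots> = (\<integral>\<^sup>+\<eta>. ennreal (C ^ 4 * ?g \<eta>) * ennreal (2 * W) \<partial>lborel)"
    proof (rule nn_integral_cong)
      fix \<eta> :: 'a
      have "(\<integral>\<^sup>+\<xi>. ennreal (?h (\<eta> + \<xi>)) \<partial>lborel) = (\<integral>\<^sup>+\<xi>. ennreal (?h \<xi>) \<partial>lborel)"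
        by (subst (2) lborel_distr_plus[of \<eta>, symmetric], subst nn_integral_distr) auto
      hence sum: "(\<integral>\<^sup>+\<xi>. ennreal (?h \<xi>) + ennreal (?h (\<eta> + \<xi>)) \<partial>lborel) = ennreal (2 * W)"
        by (subst nn_integral_add) (use W0 in \<open>auto simp: W ennreal_plus[symmetric] simp del: ennreal_plus\<close>)
      have "ennreal (C ^ 4 * ?g \<eta> * (?h \<xi> + ?h (\<eta> + \<xi>)))
         = ennreal (C ^ 4 * ?g \<eta>) * (ennreal (?h \<xi>) + ennreal (?h (\<eta> + \<xi>)))" for \<xi>
        by (subst ennreal_mult) (auto simp: gauss_pos less_imp_le ennreal_plus)
      thus "(\<integral>\<^sup>+\<xi>. ennreal (C ^ 4 * ?g \<eta> * (?h \<xi> + ?h (\<eta> + \<xi>))) \<partial>lborel) = ennreal (C ^ 4 * ?g \<eta>) * ennreal (2 * W)"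
        by (simp only:) (subst nn_integral_cmult, simp, simp only: sum)
    qed
    also have "\<dots> = ennreal (2 * C ^ 4 * W) * (\<integral>\<^sup>+\<eta>. ennreal (?g \<eta>) \<partial>lborel)"
      using W0 by (subst nn_integral_cmult[symmetric], simp)
        (intro nn_integral_cong, simp add: ennreal_mult[symmetric] gauss_pos less_imp_le mult_ac)
    also have "\<dots> \<le> ennreal (2 * C ^ 4 * W) * ennreal (e' * r ^ DIM('a))"
      by (intro mult_left_mono r) simp
    also have "\<dots> = ennreal (2 * C ^ 4 * W * e' * r ^ DIM('a))"
      using W0 e' r by (subst ennreal_mult[symmetric]) (simp_all add: mult_ac)
    finally have "r ^ DIM('a) * ?J \<le> 2 * C ^ 4 * W * e' * r ^ DIM('a)"
      using W0 e' r by (subst (asm) ennreal_le_iff) simp_all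
    hence "?J \<le> 2 * C ^ 4 * W * e'"
      using r by (simp add: mult_ac)
    also have "\<dots> \<le> e"
      using den e by (simp add: e'_def field_simps)
    finally show ?thesis .
  qed
  thus ?thesis using r by blast
qed

section \<open>Gaussian decay against powers, and the support of a measure\<close>

lemma power_mult_gauss_tendsto_0:
  assumes a: "0 < a"
  shows "((\<lambda>t. t ^ n * exp (- (a * t\<^sup>2))) \<longlongrightarrow> (0::real)) at_top"
proof (rule tendsto_sandwich[where f = "\<lambda>_. 0" and h = "\<lambda>t. t ^ n / exp (a * t)"])
  have "((\<lambda>u. u ^ n / exp u) \<longlongrightarrow> (0::real)) at_top" by (rule tendsto_power_div_exp_0)
  moreover have "filterlim (\<lambda>t. a * t) at_top at_top"
    using a by (intro filterlim_tendsto_pos_mult_at_top[OF tendsto_const]) (auto simp: filterlim_ident)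
  ultimately have "((\<lambda>t. (a * t) ^ n / exp (a * t)) \<longlongrightarrow> 0) at_top"
    by (rule filterlim_compose)
  from tendsto_mult_left[OF this, of "1 / a ^ n"]
  show "((\<lambda>t. t ^ n / exp (a * t)) \<longlongrightarrow> 0) at_top"
    using a by (simp add: power_mult_distrib)
  show "\<forall>\<^sub>F t in at_top. 0 \<le> t ^ n * exp (- (a * t\<^sup>2))"
    using eventually_ge_at_top[of "0::real"] by eventually_elim simp
  show "\<forall>\<^sub>F t in at_top. t ^ n * exp (- (a * t\<^sup>2)) \<le> t ^ n / exp (a * t)"
    using eventually_ge_at_top[of "1::real"]
  proof eventually_elim
    case (elim t)
    hence "a * t \<le> a * t\<^sup>2" using a by (simp add: power2_eq_square)
    thus ?case using elim by (simp add: exp_minus field_simps)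
  qed
qed simp

lemma closed_measure_support: "closed (measure_support \<mu>)"
proof -
  have "- measure_support \<mu> = \<Union>{U. open U \<and> emeasure \<mu> U = 0}"
    by (auto simp: measure_support_def zero_less_iff_neq_zero)
  moreover have "open (\<Union>{U. open U \<and> emeasure \<mu> U = 0})" by auto
  ultimately show ?thesis by (simp add: closed_def)
qed

text \<open>The complement is a union of open null sets, and by Lindelof countably many of them
  suffice.\<close>

lemma emeasure_support_compl:
  fixes \<mu> :: "'a::euclidean_space measure"
  assumes \<mu>: "sets \<mu> = sets borel"
  shows "emeasure \<mu> (- measure_support \<mu>) = 0"
proof -
  let ?F = "{U. open U \<and> emeasure \<mu> U = 0}"
  obtain G where G: "G \<subseteq> ?F" "countable G" "\<Union>G = \<Union>?F"
    using Lindelof[of ?F] by auto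
  have "- measure_support \<mu> = \<Union>?F"
    by (auto simp: measure_support_def zero_less_iff_neq_zero)
  moreover have "(\<Union>U\<in>G. U) \<in> null_sets \<mu>"
    using G \<mu> by (intro null_sets_UN') (auto simp: null_sets_def)
  ultimately show ?thesis using G by (simp add: null_sets_def)
qed

text \<open>Discarding the null complement of the support costs no mass. This supplies compact
  pieces of the support with positive measure.\<close>

lemma emeasure_cball_support_pos:
  fixes \<mu> :: "'a::euclidean_space measure"
  assumes \<mu>: "sets \<mu> = sets borel" and "x \<in> measure_support \<mu>" "0 < \<rho>"
  shows "emeasure \<mu> (cball x \<rho> \<inter> measure_support \<mu>) > 0"
proof -
  have s: "measure_support \<mu> \<in> sets \<mu>" using closed_measure_support[of \<mu>] \<mu> by simp
  have "0 < emeasure \<mu> (ball x \<rho>)"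
    using assms by (auto simp: measure_support_def)
  also have "\<dots> \<le> emeasure \<mu> ((cball x \<rho> \<inter> measure_support \<mu>) \<union> - measure_support \<mu>)"
    using s \<mu> by (intro emeasure_mono) auto
  also have "\<dots> \<le> emeasure \<mu> (cball x \<rho> \<inter> measure_support \<mu>) + emeasure \<mu> (- measure_support \<mu>)"
    using s \<mu> by (intro emeasure_subadditive) auto
  finally show ?thesis by (simp add: emeasure_support_compl[OF \<mu>])
qed

text \<open>A measure carried by a single point has a transform of constant modulus, which
  contradicts the decay.\<close>

lemma support_two_points:
  fixes \<mu> :: "'a::euclidean_space measure"
  assumes "finite_measure \<mu>" and \<mu>[measurable_cong]: "sets \<mu> = sets borel"
    and pos: "emeasure \<mu> UNIV > 0" and \<beta>: "0 < \<beta>"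
    and dec: "\<And>\<xi>. norm (fourier_measure \<mu> \<xi>) * (1 + norm \<xi>) powr (\<beta> / 2) \<le> C"
  shows "\<exists>p q. p \<in> measure_support \<mu> \<and> q \<in> measure_support \<mu> \<and> p \<noteq> q"
proof (rule ccontr)
  interpret finite_measure \<mu> by fact
  assume "\<not> ?thesis"
  then obtain p where p: "measure_support \<mu> \<subseteq> {p}" by blast
  have "- measure_support \<mu> \<in> null_sets \<mu>"
    using emeasure_support_compl[OF \<mu>] closed_measure_support[of \<mu>] \<mu> by (auto simp: null_sets_def)
  hence AE: "AE x in \<mu>. x = p"
    using p by (auto intro!: AE_I')
  define m where "m = measure \<mu> UNIV"
  have sp: "space \<mu> = UNIV" using sets_eq_imp_space_eq[OF \<mu>] by simp
  have m: "0 < m" using pos by (simp add: m_def emeasure_eq_measure)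
  have F: "norm (fourier_measure \<mu> \<xi>) = m" for \<xi>
  proof -
    have "fourier_measure \<mu> \<xi> = (LINT x|\<mu>. unit_character p \<xi>)"
      unfolding fourier_measure_eq using AE by (intro integral_cong_AE) auto
    thus ?thesis by (simp add: m_def sp)
  qed
  have C: "0 < C" using m dec[of 0] by (simp add: F)
  obtain b :: 'a where b: "norm b = 1" using vector_choose_size[of 1] by auto
  \<comment> \<open>At a frequency of norm \<open>R\<close> the left side of the decay bound is at
    least \<open>m * R powr (\<beta> / 2) = 2 * C\<close>, which exceeds \<open>C\<close>.\<close>
  define R where "R = (2 * C / m) powr (2 / \<beta>)"
  have "R powr (\<beta> / 2) \<le> (1 + norm (R *\<^sub>R b)) powr (\<beta> / 2)"
    using \<beta> b by (intro powr_mono2) (auto simp: R_def)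
  moreover have "R powr (\<beta> / 2) = 2 * C / m"
    using \<beta> C m by (simp add: R_def powr_powr)
  ultimately have "m * (2 * C / m) \<le> C"
    using dec[of "R *\<^sub>R b"] m unfolding F by (metis mult_left_mono order_trans less_imp_le)
  thus False using m C by simp
qed

section \<open>The parallelogram\<close>

theorem parallelogram_in_measure_support:
  fixes \<mu> :: "'a::euclidean_space measure"
  assumes fin: "finite_measure \<mu>" and \<mu>[measurable_cong]: "sets \<mu> = sets borel"
    and pos: "emeasure \<mu> UNIV > 0" and \<beta>: "real DIM('a) / 2 < \<beta>"
    and dec: "\<And>\<xi>. norm (fourier_measure \<mu> \<xi>) * (1 + norm \<xi>) powr (\<beta> / 2) \<le> C"
  shows "\<exists>x y z. distinct [x, x + y, x + z, x + y + z] \<and> {x, x + y, x + z, x + y + z} \<subseteq> measure_support \<mu>"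
proof (rule ccontr)
  assume none: "\<not> ?thesis"
  interpret P: finite_measure "quad_measure \<mu>" by (rule finite_measure_quad[OF fin])
  note [measurable] = measurable_quad[OF \<mu>]
  have "0 < \<beta>" using \<beta> by (simp add: order_le_less_trans[rotated])
  from support_two_points[OF fin \<mu> pos this dec]
  obtain p q where pq: "p \<in> measure_support \<mu>" "q \<in> measure_support \<mu>" "p \<noteq> q" by blast
  \<comment> \<open>A third of the distance, so that the two closed balls are disjoint.\<close>
  define \<rho> where "\<rho> = dist p q / 3"
  have \<rho>: "0 < \<rho>" using pq by (simp add: \<rho>_def)
  define K\<^sub>1 where "K\<^sub>1 = cball p \<rho> \<inter> measure_support \<mu>"
  define K\<^sub>2 where "K\<^sub>2 = cball q \<rho> \<inter> measure_support \<mu>"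
  have cpt: "compact K\<^sub>1" "compact K\<^sub>2"
    unfolding K\<^sub>1_def K\<^sub>2_def by (intro compact_Int_closed compact_cball closed_measure_support)+
  have disj: "u \<noteq> v" if "u \<in> K\<^sub>1" "v \<in> K\<^sub>2" for u v
  proof
    assume "u = v"
    hence "dist p q \<le> 2 * \<rho>"
      using that dist_triangle[of p q u] by (auto simp: K\<^sub>1_def K\<^sub>2_def dist_commute)
    thus False using \<rho> by (simp add: \<rho>_def)
  qed
  \<comment> \<open>A zero of \<open>alt_sum\<close> gives the parallelogram with
    \<open>x = b\<close>, \<open>y = a - b\<close>, \<open>z = d - b\<close>. Points of different
    pieces differ by disjointness, and \<open>c \<noteq> d\<close> follows from
    \<open>a \<noteq> b\<close>.\<close>
  have alt: "a - b - c + d \<noteq> 0" if abcd: "a \<in> K\<^sub>1" "b \<in> K\<^sub>1" "c \<in> K\<^sub>2" "d \<in> K\<^sub>2" and ab: "a \<noteq> b" for a b c d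
  proof
    assume eq: "a - b - c + d = 0"
    have pts: "b + (a - b) = a" "b + (d - b) = d" "b + (a - b) + (d - b) = c"
      using eq by (simp_all add: algebra_simps)
    have "c \<noteq> d" using eq ab by auto
    hence "distinct [b, a, d, c]" using disj abcd ab by auto
    moreover have "{b, a, d, c} \<subseteq> measure_support \<mu>" using abcd by (auto simp: K\<^sub>1_def K\<^sub>2_def)
    ultimately show False using none pts by metis
  qed
  define S where "S = (K\<^sub>1 \<times> K\<^sub>1) \<times> (K\<^sub>2 \<times> K\<^sub>2)"
  have "compact S" unfolding S_def by (intro compact_Times cpt)
  have "emeasure \<mu> K\<^sub>1 > 0" "emeasure \<mu> K\<^sub>2 > 0"
    unfolding K\<^sub>1_def K\<^sub>2_def using pq \<rho> by (auto intro!: emeasure_cball_support_pos \<mu>)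
  from localized_energy[OF fin \<mu> _ _ this] cpt
  obtain c where c: "0 < c" "\<And>t. 1 \<le> t \<Longrightarrow>
     c \<le> (LINT \<omega>|quad_measure \<mu>. indicator S \<omega> * (t ^ DIM('a) * gauss t (alt_sum \<omega>)))"
    unfolding S_def by (auto intro: borel_compact)
  \<comment> \<open>The factor \<open>exp pi\<close> pays for bounding the indicator of
    \<open>norm (a - b) < 1 / r\<close> by \<open>exp pi * gauss r (a - b)\<close>; half of
    \<open>c\<close> then remains for the rest.\<close>
  have "0 < c / (2 * exp pi)" using c by simp
  from diagonal_energy_small[OF fin \<mu> \<beta> dec this]
  obtain r where r: "0 < r" and J: "\<And>t. 0 < t \<Longrightarrow>
     (LINT \<omega>|quad_measure \<mu>. gauss r (pair_diff \<omega>) * (t ^ DIM('a) * gauss t (alt_sum \<omega>))) \<le> c / (2 * exp pi)"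
    by blast
  \<comment> \<open>The part of \<open>S\<close> away from the diagonal. The inequality is not
    strict, which makes \<open>T\<close> closed and hence compact.\<close>
  define T where "T = S \<inter> {\<omega>. 1 / r \<le> norm (pair_diff \<omega>)}"
  have cont: "continuous_on UNIV (pair_diff :: _ \<Rightarrow> 'a)" "continuous_on A (alt_sum :: _ \<Rightarrow> 'a)" for A
    unfolding pair_diff_def[abs_def] alt_sum_def[abs_def] by (intro continuous_intros)+
  have "closed {\<omega>::('a \<times> 'a) \<times> ('a \<times> 'a). 1 / r \<le> norm (pair_diff \<omega>)}"
    by (intro closed_Collect_le continuous_intros cont)
  hence "compact T" unfolding T_def using \<open>compact S\<close> by (intro compact_Int_closed)
  hence "compact ((\<lambda>\<omega>. norm (alt_sum \<omega>)) ` T)"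
    by (intro compact_continuous_image continuous_intros cont)
  moreover have "0 \<notin> (\<lambda>\<omega>. norm (alt_sum \<omega>)) ` T"
  proof
    assume "0 \<in> (\<lambda>\<omega>. norm (alt_sum \<omega>)) ` T"
    then obtain a b c d where "a \<in> K\<^sub>1" "b \<in> K\<^sub>1" "c \<in> K\<^sub>2" "d \<in> K\<^sub>2"
      "1 / r \<le> norm (a - b)" "a - b - c + d = 0"
      by (auto simp: T_def S_def alt_sum_def pair_diff_def)
    moreover have "0 < 1 / r" using r by simp
    ultimately show False using alt[of a b c d] by (cases "a = b") auto
  qed
  ultimately obtain \<delta> where \<delta>: "0 < \<delta>" "\<And>\<omega>. \<omega> \<in> T \<Longrightarrow> \<delta> \<le> norm (alt_sum \<omega>)"
    using separate_point_closed[of "(\<lambda>\<omega>. norm (alt_sum \<omega>)) ` T" 0] by (auto simp: compact_imp_closed)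
  define m where "m = measure (quad_measure \<mu>) (space (quad_measure \<mu>))"
  have S[measurable]: "S \<in> sets (quad_measure \<mu>)"
    unfolding S_def quad_measure_def using cpt \<mu> by (intro pair_measureI) (auto intro: borel_compact)
  have main: "c / 2 \<le> m * (t ^ DIM('a) * exp (- (pi * \<delta>\<^sup>2 * t\<^sup>2)))" if t: "1 \<le> t" for t
  proof -
    have X: "integrable (quad_measure \<mu>) (\<lambda>\<omega>. u \<omega> * (t ^ DIM('a) * gauss t (alt_sum \<omega>)))"
      if [measurable]: "u \<in> borel_measurable (quad_measure \<mu>)" and "\<And>\<omega>. \<bar>u \<omega>\<bar> \<le> 1" for u
      using that t by (intro P.integrable_const_bound[where B="t ^ DIM('a)"])
        (auto simp: abs_mult gauss_pos gauss_le_1 abs_of_pos less_imp_le intro!: mult_le_one mult_left_le_one_le 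
           AE_I2 order_trans[OF mult_left_le_one_le mult_left_le])
    have "c \<le> (LINT \<omega>|quad_measure \<mu>. indicator S \<omega> * (t ^ DIM('a) * gauss t (alt_sum \<omega>)))"
      by (rule c(2)[OF t])
    \<comment> \<open>Pointwise: off \<open>S\<close> the left side is 0, on \<open>T\<close> the
      second term dominates, and on the rest of \<open>S\<close> the first one does.\<close>
    also have "\<dots> \<le> (LINT \<omega>|quad_measure \<mu>. exp pi * (gauss r (pair_diff \<omega>) * (t ^ DIM('a) * gauss t (alt_sum \<omega>)))
        + t ^ DIM('a) * exp (- (pi * \<delta>\<^sup>2 * t\<^sup>2)))"
    proof (rule integral_mono)
      fix \<omega> :: "('a \<times> 'a) \<times> ('a \<times> 'a)"
      let ?G = "t ^ DIM('a) * gauss t (alt_sum \<omega>)" and ?E = "t ^ DIM('a) * exp (- (pi * \<delta>\<^sup>2 * t\<^sup>2))"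
      have G: "0 \<le> ?G" "0 \<le> ?E" using t by (simp_all add: gauss_pos less_imp_le)
      have GG: "0 \<le> exp pi * (gauss r (pair_diff \<omega>) * ?G)"
        by (intro mult_nonneg_nonneg[OF exp_ge_zero] mult_nonneg_nonneg[OF _ G(1)]) (simp add: gauss_pos less_imp_le)
      consider "\<omega> \<notin> S" | "\<omega> \<in> T" | "\<omega> \<in> S" "norm (pair_diff \<omega>) < 1 / r"
        unfolding T_def by (metis (no_types) IntI mem_Collect_eq not_le)
      thus "indicator S \<omega> * ?G \<le> exp pi * (gauss r (pair_diff \<omega>) * ?G) + ?E"
      proof cases
        case 1 thus ?thesis using G GG by simp
      next
        case 2
        hence "\<delta>\<^sup>2 \<le> (norm (alt_sum \<omega>))\<^sup>2" using \<delta> by (intro power_mono) auto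
        hence "pi * t\<^sup>2 * \<delta>\<^sup>2 \<le> pi * t\<^sup>2 * (norm (alt_sum \<omega>))\<^sup>2"
          by (rule mult_left_mono) simp
        hence "gauss t (alt_sum \<omega>) \<le> exp (- (pi * \<delta>\<^sup>2 * t\<^sup>2))"
          unfolding gauss_def by (simp add: mult_ac)
        hence "?G \<le> ?E" using t by (intro mult_left_mono) auto
        thus ?thesis using 2 GG by (simp add: T_def)
      next
        case 3
        hence "r * norm (pair_diff \<omega>) \<le> 1" using r by (simp add: field_simps)
        hence "(r * norm (pair_diff \<omega>))\<^sup>2 \<le> 1" using r by (intro power_le_one) auto
        hence "- pi \<le> - pi * r\<^sup>2 * (norm (pair_diff \<omega>))\<^sup>2"
          using mult_left_mono[of "(r * norm (pair_diff \<omega>))\<^sup>2" 1 pi] by (simp add: power_mult_distrib mult_ac)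
        hence "exp (- pi) \<le> gauss r (pair_diff \<omega>)" unfolding gauss_def by simp
        hence "exp pi * exp (- pi) \<le> exp pi * gauss r (pair_diff \<omega>)" by (intro mult_left_mono) auto
        hence "1 \<le> exp pi * gauss r (pair_diff \<omega>)" by (simp add: exp_minus)
        hence "1 * ?G \<le> exp pi * gauss r (pair_diff \<omega>) * ?G" using G by (intro mult_right_mono)
        thus ?thesis using 3 G by (simp add: mult.assoc)
      qed
    qed (auto intro!: X Bochner_Integration.integrable_add integrable_mult_right simp: gauss_le_1 gauss_pos abs_of_pos indicator_def)
    also have "\<dots> = exp pi * (LINT \<omega>|quad_measure \<mu>. gauss r (pair_diff \<omega>) * (t ^ DIM('a) * gauss t (alt_sum \<omega>)))
        + m * (t ^ DIM('a) * exp (- (pi * \<delta>\<^sup>2 * t\<^sup>2)))"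
      by (subst Bochner_Integration.integral_add)
        (auto intro!: X integrable_mult_right simp: gauss_le_1 gauss_pos abs_of_pos m_def)
    also have "\<dots> \<le> exp pi * (c / (2 * exp pi)) + m * (t ^ DIM('a) * exp (- (pi * \<delta>\<^sup>2 * t\<^sup>2)))"
      using t by (intro add_right_mono mult_left_mono J) auto
    finally show ?thesis by simp
  qed
  \<comment> \<open>\<open>\<delta>\<close> and \<open>r\<close> do not depend on \<open>t\<close>,
    so \<open>t\<close> may now tend to infinity, which forces \<open>c / 2 \<le> 0\<close>.\<close>
  have "((\<lambda>t. m * (t ^ DIM('a) * exp (- (pi * \<delta>\<^sup>2 * t\<^sup>2)))) \<longlongrightarrow> m * 0) at_top"
    using \<delta> by (intro tendsto_intros power_mult_gauss_tendsto_0) simp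
  moreover have "\<forall>\<^sub>F t in at_top. c / 2 \<le> m * (t ^ DIM('a) * exp (- (pi * \<delta>\<^sup>2 * t\<^sup>2)))"
    using eventually_ge_at_top[of "1::real"] by eventually_elim (rule main)
  ultimately have "c / 2 \<le> m * 0"
    by (rule tendsto_lowerbound) simp
  thus False using c by simp
qed

theorem corollary1p10:
  fixes C :: real
  assumes "CARD('n::finite) \<ge> 2"
  shows "\<exists>\<epsilon>\<^sub>0>0. \<forall>(E :: (real^'n) set) (\<mu> :: (real^'n) measure) (\<alpha>::real) (\<beta>::real).
    E \<in> null_sets lebesgue \<and>
    radon_measure \<mu> \<and> finite_measure \<mu> \<and> emeasure \<mu> UNIV > 0 \<and>
    measure_support \<mu> \<subseteq> E \<and>
    real CARD('n) - \<epsilon>\<^sub>0 < \<alpha> \<and> \<alpha> < real CARD('n) \<and>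
    real CARD('n) / 2 < \<beta> \<and> \<beta> < real CARD('n) \<and>
    (SUP x\<in>E. SUP \<rho>\<in>{0<..<1::real}. ereal (measure \<mu> (ball x \<rho>) / \<rho> powr \<alpha>)) \<le> ereal C \<and>
    (SUP \<xi>\<in>UNIV. ereal (norm (fourier_measure \<mu> \<xi>) * (1 + norm \<xi>) powr (\<beta> / 2))) \<le> ereal C
    \<longrightarrow> (\<exists>x y z. distinct [x, x + y, x + z, x + y + z] \<and> {x, x + y, x + z, x + y + z} \<subseteq> E)"
proof (rule exI[of _ 1], intro conjI allI impI, goal_cases)
  case (2 E \<mu> \<alpha> \<beta>)
  \<comment> \<open>The bound on the supremum in \<open>ereal\<close> becomes a pointwise decay
    estimate with the same \<open>C\<close>.\<close>
  hence "norm (fourier_measure \<mu> \<xi>) * (1 + norm \<xi>) powr (\<beta> / 2) \<le> C" for \<xi>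
    by (simp add: SUP_le_iff)
  moreover have "sets \<mu> = sets borel" using 2 by (simp add: radon_measure_def)
  ultimately have "\<exists>x y z. distinct [x, x + y, x + z, x + y + z] \<and> {x, x + y, x + z, x + y + z} \<subseteq> measure_support \<mu>"
    using 2 by (intro parallelogram_in_measure_support[where C=C and \<beta>=\<beta>]) auto
  thus ?case using 2 by (meson order_trans)
qed simp

end
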